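(* Let $\mathcal{H}$ be a real Hilbert space, $P,S\in\mathcal{P}(\mathcal{H})$ and $\beta\in[0,4)$. Assume that $A:\mathcal{H}\to 2^{\mathcal{H}}$ is maximally monotone, that $C:\mathcal{H}\to\mathcal{H}$ is $\frac1\beta$-cocoercive w.r.t. $\|\cdot\|_P$, that $\mathrm{zer}(A+C):=\{x\in\mathcal{H}:0\in Ax+Cx\}\neq\emptyset$, and that for every $k\in\mathbb{N}$ the operator $M_k:\mathcal{H}\to\mathcal{H}$ is (single-valued and) maximally monotone, $1$-strongly monotone w.r.t. $\|\cdot\|_P$, and $L_M$-Lipschitz continuous w.r.t. $\|\cdot\|$ (with $L_M$ independent of $k$). Let $\theta_k\in[\epsilon_\theta,2-\epsilon_\theta]$ for all $k$, for some $\epsilon_\theta\in(0,1)$. Let $x_0\in\mathcal{H}$ and, for $k=0,1,\ldots$, let $$\hat x_k:=(M_k+A)^{-1}(M_k-C)x_k,$$ $$H_k:=\{z\in\mathcal{H}:\langle M_kx_k-M_k\hat x_k,z-\hat x_k\rangle\le\tfrac{\beta}{4}\|x_k-\hat x_k\|_P^2\},$$ $$x_{k+1}:=(1-\theta_k)x_k+\theta_k\Pi^S_{H_k}(x_k).$$ Suppose further that $A+C$ is metrically subregular at every $z\in\mathrm{zer}(A+C)$ for $0$, and that either $\mathcal{H}$ is finite-dimensional or, at every $z\in\mathrm{zer}(A+C)$, the neighborhood $\mathcal{U}$ in the definition of metric subregularity is $\mathcal{U}=\mathcal{H}$. Then $\mathrm{dist}_S(x_k,\mathrm{zer}(A+C))$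 converges locally Q-linearly to zero, and $x_k\to\bar x$ locally R-linearly for some $\bar x\in\mathrm{zer}(A+C)$.
   Context: $\mathcal{P}(\mathcal{H})$ is the set of bounded linear self-adjoint positive definite operators on $\mathcal{H}$ (positive definite in the sense that there are $0<\lambda_{\min}(P)\le\lambda_{\max}(P)<\infty$ with $\lambda_{\min}(P)\|x\|^2\le\langle x,Px\rangle\le\lambda_{\max}(P)\|x\|^2$ for all $x$); $\|x\|_P=\sqrt{\langle x,Px\rangle}$. $C$ is $\frac1\beta$-cocoercive w.r.t. $\|\cdot\|_P$ if $\langle Cx-Cy,x-y\rangle\ge\frac1\beta\|Cx-Cy\|_{P^{-1}}^2$ for all $x,y$; for $\beta=0$ this means that $C$ is constant. $M_k$ is $1$-strongly monotone w.r.t. $\|\cdot\|_P$ if $\langle M_kx-M_ky,x-y\rangle\ge\|x-y\|_P^2$ for all $x,y$. $\Pi_H^S(x)=\mathrm{argmin}_{y\in H}\|x-y\|_S$ is the projection onto a nonempty closed convex set $H$ in $\|\cdot\|_S$, and $\mathrm{dist}_S(x,H)=\inf_{y\in H}\|x-y\|_S$ (equal to $+\infty$ if $H=\emptyset$). Metric subregularity: $F:\mathcal{H}\to2^{\mathcal{H}}$ is metrically subregular at $\bar x$ for $\bar y$ if $\bar y\in F\bar x$ and there exist $\kappa\in[0,\infty)$ and neighborhoods $\mathcal{U}$ of $\bar x$ and $\mathcal{V}$ of $\bar y$ such that $\mathrm{dist}_S(x,F^{-1}\bar y)\le\kappa\,\mathrm{dist}_S(\bar y,Fx\cap\mathcal{V})$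 for all $x\in\mathcal{U}$. A nonnegative sequence $(d_k)$ converges locally Q-linearly to zero if there are $K\in\mathbb{N}$ and $c\in[0,1)$ with $d_{k+1}\le c\,d_k$ for all $k\ge K$; $x_k\to\bar x$ locally R-linearly if there are $K\in\mathbb{N}$, $R\ge0$ and $c\in[0,1)$ with $\|x_k-\bar x\|_S\le Rc^k$ for all $k\ge K$. *)

theory Defs
  imports "HOL-Analysis.Analysis"
begin

definition pos_def_op :: "('a::real_inner \<Rightarrow> 'a) \<Rightarrow> bool" where
  "pos_def_op P \<longleftrightarrow> bounded_linear P \<and> (\<forall>x y. P x \<bullet> y = x \<bullet> P y) \<and>
     (\<exists>l u. 0 < l \<and> l \<le> u \<and> (\<forall>x. l * (norm x)\<^sup>2 \<le> x \<bullet> P x \<and> x \<bullet> P x \<le> u * (norm x)\<^sup>2))"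

definition norm_op :: "('a::real_inner \<Rightarrow> 'a) \<Rightarrow> 'a \<Rightarrow> real" where
  "norm_op P x = sqrt (x \<bullet> P x)"

text \<open>Set-valued operators are functions into sets. A single-valued operator \<open>f\<close> is
  identified with \<open>single f\<close>, and \<open>+\<close> on sets is the Minkowski sum.\<close>

definition single :: "('a \<Rightarrow> 'b) \<Rightarrow> 'a \<Rightarrow> 'b set" where
  "single f x = {f x}"

definition op_sum :: "('a \<Rightarrow> 'b::plus set) \<Rightarrow> ('a \<Rightarrow> 'b set) \<Rightarrow> 'a \<Rightarrow> 'b set" where
  "op_sum F G x = F x + G x"

definition op_inverse :: "('a \<Rightarrow> 'b set) \<Rightarrow> 'b \<Rightarrow> 'a set" where
  "op_inverse F y = {x. y \<in> F x}"

definition zer :: "('a \<Rightarrow> 'b::zero set) \<Rightarrow> 'a set" where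
  "zer F = {x. 0 \<in> F x}"

definition monotone_op :: "('a::real_inner \<Rightarrow> 'a set) \<Rightarrow> bool" where
  "monotone_op F \<longleftrightarrow> (\<forall>x y. \<forall>u\<in>F x. \<forall>v\<in>F y. 0 \<le> (u - v) \<bullet> (x - y))"

definition maximally_monotone :: "('a::real_inner \<Rightarrow> 'a set) \<Rightarrow> bool" where
  "maximally_monotone F \<longleftrightarrow> monotone_op F \<and>
     (\<forall>G. monotone_op G \<longrightarrow> (\<forall>x. F x \<subseteq> G x) \<longrightarrow> G = F)"

definition one_strongly_monotone ::
    "('a::real_inner \<Rightarrow> 'a) \<Rightarrow> ('a \<Rightarrow> 'a) \<Rightarrow> bool" where
  "one_strongly_monotone P M \<longleftrightarrow> (\<forall>x y. (M x - M y) \<bullet> (x - y) \<ge> (norm_op P (x - y))\<^sup>2)"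

text \<open>\<open>inverse_cocoercive P \<beta> C\<close> says that \<open>C\<close> is \<open>1/\<beta>\<close>-cocoercive with respect to the
  \<open>P\<close>-norm. The case \<open>\<beta> = 0\<close> is separate because \<open>1 / 0 = 0\<close> in HOL. A positive definite
  \<open>P\<close> is a bijection of a Hilbert space, so \<open>inv P\<close> is its genuine inverse.\<close>

definition inverse_cocoercive ::
    "('a::real_inner \<Rightarrow> 'a) \<Rightarrow> real \<Rightarrow> ('a \<Rightarrow> 'a) \<Rightarrow> bool" where
  "inverse_cocoercive P \<beta> C \<longleftrightarrow>
     (if \<beta> = 0 then \<exists>c. \<forall>x. C x = c
      else \<forall>x y. (C x - C y) \<bullet> (x - y) \<ge> 1 / \<beta> * (norm_op (inv P) (C x - C y))\<^sup>2)"

text \<open>\<open>arg_min_on\<close> picks some minimiser; on a nonempty closed convex \<open>H\<close> it is unique.\<close>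

definition proj_op :: "('a::real_inner \<Rightarrow> 'a) \<Rightarrow> 'a set \<Rightarrow> 'a \<Rightarrow> 'a" where
  "proj_op S H x = arg_min_on (\<lambda>y. norm_op S (x - y)) H"

text \<open>Extended-real valued, so that the distance to the empty set is \<open>\<infinity>\<close>.\<close>

definition dist_op :: "('a::real_inner \<Rightarrow> 'a) \<Rightarrow> 'a \<Rightarrow> 'a set \<Rightarrow> ereal" where
  "dist_op S x H = (INF y\<in>H. ereal (norm_op S (x - y)))"

text \<open>The neighborhood \<open>U\<close> of \<open>x0\<close> is a parameter here, so that the choice \<open>U = UNIV\<close> can be
  expressed. The convention \<open>0 * \<infinity> = 0\<close> for \<open>ereal\<close> is harmless: \<open>\<kappa> = 0\<close> can always be
  replaced by \<open>\<kappa> = 1\<close>.\<close>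

definition metrically_subregular_on ::
    "('a::real_inner \<Rightarrow> 'a) \<Rightarrow> ('a \<Rightarrow> 'a set) \<Rightarrow> 'a \<Rightarrow> 'a \<Rightarrow> 'a set \<Rightarrow> bool" where
  "metrically_subregular_on S F x0 y0 U \<longleftrightarrow> y0 \<in> F x0 \<and> x0 \<in> interior U \<and>
     (\<exists>\<kappa>\<ge>0. \<exists>V. y0 \<in> interior V \<and>
        (\<forall>x\<in>U. dist_op S x (op_inverse F y0) \<le> ereal \<kappa> * dist_op S y0 (F x \<inter> V)))"

definition metrically_subregular ::
    "('a::real_inner \<Rightarrow> 'a) \<Rightarrow> ('a \<Rightarrow> 'a set) \<Rightarrow> 'a \<Rightarrow> 'a \<Rightarrow> bool" where
  "metrically_subregular S F x0 y0 \<longleftrightarrow> (\<exists>U. metrically_subregular_on S F x0 y0 U)"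

definition locally_Q_linear_to_zero :: "(nat \<Rightarrow> real) \<Rightarrow> bool" where
  "locally_Q_linear_to_zero d \<longleftrightarrow> (\<forall>k. 0 \<le> d k) \<and>
     (\<exists>K. \<exists>c\<ge>0. c < 1 \<and> (\<forall>k\<ge>K. d (Suc k) \<le> c * d k))"

definition locally_R_linear_to ::
    "('a::real_inner \<Rightarrow> 'a) \<Rightarrow> (nat \<Rightarrow> 'a) \<Rightarrow> 'a \<Rightarrow> bool" where
  "locally_R_linear_to S x l \<longleftrightarrow>
     (\<exists>K. \<exists>R\<ge>0. \<exists>c\<ge>0. c < 1 \<and> (\<forall>k\<ge>K. norm_op S (x k - l) \<le> R * c ^ k))"

end

theory Submission
  imports Defs
begin

text \<open>Monotonicity of \<open>A\<close> and cocoercivity of \<open>C\<close> put every zero of \<open>A + C\<close> into the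
  halfspace \<open>H\<^sub>k\<close>, so the relaxed projections are Fejer monotone: for every zero \<open>z\<close>,
  \<open>\<parallel>x\<^sub>k\<^sub>+\<^sub>1 - z\<parallel>\<^sub>S\<^sup>2\<close> is at most \<open>\<parallel>x\<^sub>k - z\<parallel>\<^sub>S\<^sup>2\<close> minus a multiple of the squared distance from
  \<open>x\<^sub>k\<close> to \<open>H\<^sub>k\<close>, and that distance is at least a multiple of the residual
  \<open>\<parallel>x\<^sub>k - xh\<^sub>k\<parallel>\<close>, because \<open>M\<^sub>k\<close> is strongly monotone and Lipschitz and \<open>\<beta> < 4\<close>. Hence the
  residuals tend to zero, and so do the elements
  \<open>u\<^sub>k = M\<^sub>k x\<^sub>k - M\<^sub>k xh\<^sub>k - C x\<^sub>k + C xh\<^sub>k\<close> of \<open>(A + C) xh\<^sub>k\<close>. In finite dimension a cluster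
  point of \<open>x\<close> is therefore a zero, and Fejer monotonicity makes it the limit, so that
  \<open>xh\<^sub>k\<close> eventually enters the neighborhood of metric subregularity. Subregularity then bounds
  the distance of \<open>x\<^sub>k\<close> to the zeros by a multiple of the residual. Taking the infimum over
  \<open>z\<close> in the Fejer inequality gives Q-linear decay of the distance. Since Fejer monotonicity
  also bounds \<open>\<parallel>x\<^sub>j - x\<^sub>k\<parallel>\<close> for \<open>j \<ge> k\<close> by a multiple of the distance at \<open>x\<^sub>k\<close>, the iterates
  converge R-linearly.\<close>

section \<open>Positive definite operators and the norms they induce\<close>

lemma pos_def_opE:
  fixes P :: "'a::real_inner \<Rightarrow> 'a"
  assumes "pos_def_op P"
  obtains l u where "0 < l" "0 < u" "bounded_linear P" "\<And>x y. P x \<bullet> y = x \<bullet> P y"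
    "\<And>x. l * (norm x)\<^sup>2 \<le> x \<bullet> P x" "\<And>x. x \<bullet> P x \<le> u * (norm x)\<^sup>2"
  using assms unfolding pos_def_op_def by (metis order_less_le_trans)

lemma norm_op_square: "pos_def_op P \<Longrightarrow> (norm_op P x)\<^sup>2 = x \<bullet> P x"
  unfolding norm_op_def
  by (metis pos_def_opE mult_nonneg_nonneg less_imp_le order_trans real_sqrt_pow2 zero_le_power2)

lemma norm_op_nonneg: "pos_def_op P \<Longrightarrow> 0 \<le> norm_op P x"
  unfolding norm_op_def
  by (metis pos_def_opE mult_nonneg_nonneg less_imp_le order_trans real_sqrt_ge_zero zero_le_power2)

lemma norm_op_equivalent_norm:
  fixes P :: "'a::real_inner \<Rightarrow> 'a"
  assumes "pos_def_op P"
  obtains a b where "0 < a" "0 < b" "\<And>x. a * norm x \<le> norm_op P x" "\<And>x. norm_op P x \<le> b * norm x"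
proof -
  obtain l u where lu: "0 < l" "0 < u" "\<And>x. l * (norm x)\<^sup>2 \<le> x \<bullet> P x"
      "\<And>x. x \<bullet> P x \<le> u * (norm x)\<^sup>2"
    using pos_def_opE[OF assms] by metis
  have "sqrt l * norm x \<le> norm_op P x" "norm_op P x \<le> sqrt u * norm x" for x
    using lu(3,4)[of x, THEN real_sqrt_le_mono] by (simp_all add: norm_op_def real_sqrt_mult)
  then show thesis using lu that[of "sqrt l" "sqrt u"] by simp
qed

lemma norm_op_minus_commute:
  assumes "pos_def_op P" shows "norm_op P (x - y) = norm_op P (y - x)"
proof -
  have "linear P" using assms by (simp add: pos_def_op_def bounded_linear.linear)
  then have "P (x - y) = - P (y - x)"
    by (metis linear_neg minus_diff_eq)
  then show ?thesis
    by (metis inner_minus_left inner_minus_right minus_diff_eq minus_minus norm_op_def)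
qed

lemma norm_op_square_add:
  assumes "pos_def_op P"
  shows "(norm_op P (x + y))\<^sup>2 = (norm_op P x)\<^sup>2 + 2 * (x \<bullet> P y) + (norm_op P y)\<^sup>2"
proof -
  obtain "linear P" "\<And>x y. P x \<bullet> y = x \<bullet> P y"
    using assms by (simp add: pos_def_op_def bounded_linear.linear)
  then have "y \<bullet> P x = x \<bullet> P y" by (metis inner_commute)
  then show ?thesis
    using \<open>linear P\<close> by (simp add: norm_op_square[OF assms] linear_add inner_add_left inner_add_right)
qed

text \<open>Solving \<open>P y = b\<close> is finding a fixed point of \<open>y \<mapsto> y - t (P y - b)\<close>, a contraction
  for small \<open>t > 0\<close>.\<close>

lemma pos_def_op_bij:
  fixes P :: "'a::{real_inner, complete_space} \<Rightarrow> 'a"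
  assumes "pos_def_op P"
  shows "bij P"
proof -
  obtain l u where l: "0 < l" and P: "bounded_linear P"
    and low: "\<And>x. l * (norm x)\<^sup>2 \<le> x \<bullet> P x"
    using pos_def_opE[OF assms] by metis
  obtain K where K: "0 < K" "\<And>x. norm (P x) \<le> norm x * K"
    using bounded_linear.pos_bounded[OF P] by metis
  have diff: "P (x - y) = P x - P y" for x y
    using P by (simp add: bounded_linear.linear linear_diff)
  \<comment> \<open>This step size satisfies \<open>t * K\<^sup>2 \<le> l\<close>, so
    \<open>q \<le> 1 - t * l < 1\<close>.\<close>
  define t where "t = l / (K\<^sup>2 + l\<^sup>2)"
  have D: "0 < K\<^sup>2 + l\<^sup>2" using l by (simp add: add_nonneg_pos)
  then have t: "0 < t" using l by (simp add: t_def)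
  define q where "q = 1 - 2 * t * l + t\<^sup>2 * K\<^sup>2"
  have "t\<^sup>2 * K\<^sup>2 \<le> t * l"
  proof -
    have "t * K\<^sup>2 \<le> l" using D l by (simp add: t_def field_simps power2_eq_square)
    then show ?thesis using t by (simp add: power2_eq_square mult.assoc)
  qed
  moreover have "t * l > 0" using t l by simp
  ultimately have q1: "q < 1" by (simp add: q_def)
  have contr: "(norm (y - t *\<^sub>R P y))\<^sup>2 \<le> q * (norm y)\<^sup>2" for y
  proof -
    have "(norm (P y))\<^sup>2 \<le> (norm y * K)\<^sup>2" using K(2)[of y] by (simp add: power_mono)
    then have "t\<^sup>2 * (norm (P y))\<^sup>2 \<le> t\<^sup>2 * (norm y * K)\<^sup>2" by (simp add: mult_left_mono)
    moreover have "2 * t * (l * (norm y)\<^sup>2) \<le> 2 * t * (y \<bullet> P y)"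
      using t low[of y] by (simp add: mult_left_mono)
    moreover have "(norm (y - t *\<^sub>R P y))\<^sup>2 = (norm y)\<^sup>2 - 2 * t * (y \<bullet> P y) + t\<^sup>2 * (norm (P y))\<^sup>2"
      unfolding power2_norm_eq_inner
      by (simp add: inner_diff_left inner_diff_right inner_commute power2_eq_square algebra_simps)
    ultimately show ?thesis by (simp add: q_def algebra_simps power_mult_distrib)
  qed
  define c where "c = sqrt (max 0 q)"
  have c: "0 \<le> c" "c < 1" using q1 by (simp_all add: c_def)
  have contr': "norm (y - t *\<^sub>R P y) \<le> c * norm y" for y
  proof -
    have "q * (norm y)\<^sup>2 \<le> max 0 q * (norm y)\<^sup>2"
      by (rule mult_right_mono) auto
    then have "(norm (y - t *\<^sub>R P y))\<^sup>2 \<le> (c * norm y)\<^sup>2"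
      using contr[of y] by (simp add: c_def power_mult_distrib)
    then show ?thesis using c(1) by (metis mult_nonneg_nonneg norm_ge_zero power2_le_imp_le)
  qed
  have "\<exists>y. P y = b" for b
  proof -
    have "dist (x - t *\<^sub>R (P x - b)) (y - t *\<^sub>R (P y - b)) \<le> c * dist x y" for x y
      using contr'[of "x - y"] by (simp add: dist_norm diff algebra_simps)
    then obtain y where "y - t *\<^sub>R (P y - b) = y"
      using banach_fix_type[OF c, of "\<lambda>y. y - t *\<^sub>R (P y - b)"] by blast
    then show ?thesis using t by auto
  qed
  then have "surj P" by (metis surjI)
  moreover have "inj P"
  proof (rule injI)
    fix x y assume "P x = P y"
    then have "l * (norm (x - y))\<^sup>2 \<le> 0" using low[of "x - y"] by (simp add: diff)
    moreover have "0 \<le> l * (norm (x - y))\<^sup>2" using l by simp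
    ultimately show "x = y" using l by simp
  qed
  ultimately show ?thesis by (simp add: bij_def)
qed

section \<open>Projection onto a halfspace\<close>

text \<open>\<open>proj_op\<close> only picks some minimiser, so a minimiser has to be exhibited
  first. The explicit point \<open>p\<close> satisfies the variational inequality, which yields a
  Pythagorean inequality; this makes \<open>p\<close> minimal and forces every other minimiser to
  coincide with it.\<close>

lemma proj_op_halfspace:
  fixes S :: "'a::{real_inner, complete_space} \<Rightarrow> 'a"
  assumes S: "pos_def_op S" and H: "H = {z. a \<bullet> z \<le> b}" and ne: "H \<noteq> {}"
  shows "proj_op S H x \<in> H"
    and "\<And>z. z \<in> H \<Longrightarrow> (x - proj_op S H x) \<bullet> S (z - proj_op S H x) \<le> 0"
proof -
  have lin: "linear S" and sym: "\<And>x y. S x \<bullet> y = x \<bullet> S y"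
    using S by (simp_all add: pos_def_op_def bounded_linear.linear)
  obtain l where l: "0 < l" "\<And>x. l * (norm x)\<^sup>2 \<le> x \<bullet> S x"
    using pos_def_opE[OF S] by metis
  have "\<exists>p\<in>H. \<forall>z\<in>H. (x - p) \<bullet> S (z - p) \<le> 0"
  proof (cases "a \<bullet> x \<le> b")
    case True
    then show ?thesis using H by (intro bexI[of _ x]) auto
  next
    case False
    then have "a \<noteq> 0" using H ne by auto
    \<comment> \<open>The vector \<open>w\<close> represents \<open>a\<close> in the
      \<open>S\<close>-inner product. Subtracting a multiple of it from \<open>x\<close> is the
      orthogonal projection there, scaled to land on the hyperplane
      \<open>a \<bullet> p = b\<close>.\<close>
    obtain w where w: "S w = a" using pos_def_op_bij[OF S] by (metis bij_pointE)
    then have "w \<noteq> 0" using \<open>a \<noteq> 0\<close> linear_0[OF lin] by auto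
    then have "0 < l * (norm w)\<^sup>2" using l by simp
    also have "\<dots> \<le> a \<bullet> w" using l(2)[of w] w by (simp add: inner_commute)
    finally have aw: "0 < a \<bullet> w" .
    define p where "p = x - ((a \<bullet> x - b) / (a \<bullet> w)) *\<^sub>R w"
    have ap: "a \<bullet> p = b" using aw by (simp add: p_def inner_diff_right)
    have "(x - p) \<bullet> S (z - p) \<le> 0" if "z \<in> H" for z
    proof -
      have "(x - p) \<bullet> S (z - p) = (a \<bullet> x - b) / (a \<bullet> w) * (a \<bullet> (z - p))"
        using sym[of w "z - p"] w by (simp add: p_def)
      also have "a \<bullet> (z - p) \<le> 0" using that H ap by (simp add: inner_diff_right)
      then have "(a \<bullet> x - b) / (a \<bullet> w) * (a \<bullet> (z - p)) \<le> 0"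
        using aw False by (intro mult_nonneg_nonpos) auto
      finally show ?thesis .
    qed
    moreover have "p \<in> H" using ap H by simp
    ultimately show ?thesis by blast
  qed
  then obtain p where p: "p \<in> H" "\<And>z. z \<in> H \<Longrightarrow> (x - p) \<bullet> S (z - p) \<le> 0" by blast
  have pyth: "(norm_op S (x - p))\<^sup>2 + (norm_op S (p - y))\<^sup>2 \<le> (norm_op S (x - y))\<^sup>2" if "y \<in> H" for y
  proof -
    have "S (p - y) = - S (y - p)" using lin by (metis linear_neg minus_diff_eq)
    then show ?thesis
      using norm_op_square_add[OF S, of "x - p" "p - y"] p(2)[OF that] by simp
  qed
  have "is_arg_min (\<lambda>y. norm_op S (x - y)) (\<lambda>y. y \<in> H) p"
  proof -
    have "norm_op S (x - p) \<le> norm_op S (x - y)" if "y \<in> H" for y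
    proof -
      have "(norm_op S (x - p))\<^sup>2 \<le> (norm_op S (x - y))\<^sup>2"
        using pyth[OF that] zero_le_power2[of "norm_op S (p - y)"] by linarith
      then show ?thesis using norm_op_nonneg[OF S] by (metis power2_le_imp_le)
    qed
    then show ?thesis using p(1) by (auto simp: is_arg_min_linorder)
  qed
  then have "is_arg_min (\<lambda>y. norm_op S (x - y)) (\<lambda>y. y \<in> H) (proj_op S H x)"
    unfolding proj_op_def arg_min_on_def arg_min_def by (rule someI)
  then have in_H: "proj_op S H x \<in> H" and le: "norm_op S (x - proj_op S H x) \<le> norm_op S (x - p)"
    using p(1) by (auto simp: is_arg_min_linorder)
  have "(norm_op S (x - proj_op S H x))\<^sup>2 \<le> (norm_op S (x - p))\<^sup>2"
    using le norm_op_nonneg[OF S] by (simp add: power_mono)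
  then have "(norm_op S (p - proj_op S H x))\<^sup>2 \<le> 0"
    using pyth[OF in_H] by linarith
  then have "l * (norm (p - proj_op S H x))\<^sup>2 \<le> 0"
    using l(2)[of "p - proj_op S H x"] by (simp add: norm_op_square[OF S])
  then have "p = proj_op S H x"
    using l(1) by (simp add: mult_le_0_iff)
  then show "proj_op S H x \<in> H"
    and "\<And>z. z \<in> H \<Longrightarrow> (x - proj_op S H x) \<bullet> S (z - proj_op S H x) \<le> 0"
    using p by auto
qed

section \<open>Distances to a set as real numbers\<close>

text \<open>\<open>real_of_ereal\<close> maps infinity to 0, so the real-valued distance is faithful
  only for a nonempty set.\<close>

lemma dist_op_finite:
  fixes S :: "'a::real_inner \<Rightarrow> 'a"
  assumes S: "pos_def_op S" and Z: "Z \<noteq> {}"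
  shows "dist_op S x Z = ereal (real_of_ereal (dist_op S x Z))"
    and "0 \<le> real_of_ereal (dist_op S x Z)"
proof -
  have ge: "0 \<le> dist_op S x Z"
    unfolding dist_op_def by (intro INF_greatest) (simp add: norm_op_nonneg[OF S])
  obtain z where "z \<in> Z" using Z by auto
  then have "dist_op S x Z \<le> ereal (norm_op S (x - z))"
    unfolding dist_op_def by (rule INF_lower)
  then show "dist_op S x Z = ereal (real_of_ereal (dist_op S x Z))"
    using ge by (cases "dist_op S x Z") auto
  show "0 \<le> real_of_ereal (dist_op S x Z)" using ge by (simp add: real_of_ereal_pos)
qed

lemma dist_op_le: "z \<in> Z \<Longrightarrow> dist_op S x Z \<le> ereal (norm_op S (x - z))"
  unfolding dist_op_def by (rule INF_lower)

lemma le_real_dist_op: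
  assumes S: "pos_def_op S" and Z: "Z \<noteq> {}" and "\<And>z. z \<in> Z \<Longrightarrow> r \<le> norm_op S (x - z)"
  shows "r \<le> real_of_ereal (dist_op S x Z)"
proof -
  have "ereal r \<le> dist_op S x Z"
    unfolding dist_op_def using assms(3) by (intro INF_greatest) simp
  then show ?thesis using dist_op_finite(1)[OF S Z, of x] by (metis ereal_less_eq(3))
qed

lemma real_dist_op_le:
  assumes S: "pos_def_op S" and "z \<in> Z"
  shows "real_of_ereal (dist_op S x Z) \<le> norm_op S (x - z)"
  using dist_op_le[OF assms(2), of S x] dist_op_finite(1)[OF S, of Z x] assms(2)
  by (metis ereal_less_eq(3) empty_iff)

section \<open>Compactness in finite dimension\<close>

text \<open>Finite dimension is a finite spanning set here, not a type class. Over an orthogonal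
  spanning set each coordinate is a bounded real sequence; subsequences are extracted one coordinate
  after another, and the expansion reassembles the limit.\<close>

lemma finite_span_convergent_subsequence:
  fixes f :: "nat \<Rightarrow> 'a::real_inner" and B :: "'a set"
  assumes B: "finite B" "span B = UNIV" and bd: "bounded (range f)"
  shows "\<exists>l r. strict_mono r \<and> (f \<circ> r) \<longlonglongrightarrow> l"
proof -
  obtain D where D: "finite D" "span D = span B" "pairwise orthogonal D"
    using basis_orthogonal[OF B(1)] by blast
  \<comment> \<open>\<open>D\<close> may contain 0, whose coefficient is 0 because
    \<open>x / 0 = 0\<close>. The difference of the two sides is orthogonal to \<open>D\<close>,
    hence to the whole space and to itself.\<close>
  have exp: "v = (\<Sum>c\<in>D. ((v \<bullet> c) / (c \<bullet> c)) *\<^sub>R c)" for v :: 'a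
  proof -
    define y where "y = v - (\<Sum>c\<in>D. ((v \<bullet> c) / (c \<bullet> c)) *\<^sub>R c)"
    have "y \<bullet> d = 0" if "d \<in> D" for d
    proof -
      have "(\<Sum>c\<in>D. ((v \<bullet> c) / (c \<bullet> c)) *\<^sub>R c) \<bullet> d = (\<Sum>c\<in>D. ((v \<bullet> c) / (c \<bullet> c)) * (c \<bullet> d))"
        by (simp add: inner_sum_left)
      also have "\<dots> = (\<Sum>c\<in>D. if c = d then v \<bullet> d else 0)"
        using D(3) that by (intro sum.cong) (auto simp: pairwise_def orthogonal_def)
      also have "\<dots> = v \<bullet> d" using D(1) that by simp
      finally show ?thesis by (simp add: y_def inner_diff_left)
    qed
    then have "span D \<subseteq> {w. y \<bullet> w = 0}"
      by (intro span_minimal) (auto simp: subspace_def inner_add_right)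
    then have "y \<bullet> y = 0" using D(2) B(2) by blast
    then show ?thesis by (simp add: y_def)
  qed
  have "\<exists>r. strict_mono r \<and> (\<forall>c\<in>E. convergent (\<lambda>n. f (r n) \<bullet> c))" if "finite E" for E
    using that
  proof (induction E)
    case empty
    show ?case by (intro exI[of _ id]) (simp add: strict_mono_def)
  next
    case (insert e E)
    then obtain r where r: "strict_mono r" "\<And>c. c \<in> E \<Longrightarrow> convergent (\<lambda>n. f (r n) \<bullet> c)" by blast
    obtain K where K: "\<And>n. norm (f n) \<le> K" using bd by (auto simp: bounded_iff)
    have "norm (f (r n) \<bullet> e) \<le> K * norm e" for n
      using Cauchy_Schwarz_ineq2[of "f (r n)" e] K[of "r n"]
      by (metis mult_right_mono norm_ge_zero order_trans real_norm_def)
    then have "bounded (range (\<lambda>n. f (r n) \<bullet> e))" by (auto simp: bounded_iff)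
    then obtain l s where s: "strict_mono s" "((\<lambda>n. f (r n) \<bullet> e) \<circ> s) \<longlonglongrightarrow> l"
      using bounded_imp_convergent_subsequence by blast
    have "convergent (\<lambda>n. f (r (s n)) \<bullet> c)" if "c \<in> E" for c
      using convergent_subseq_convergent[OF r(2)[OF that] s(1)] by (simp add: o_def)
    moreover have "convergent (\<lambda>n. f (r (s n)) \<bullet> e)" using s(2) by (auto simp: convergent_def o_def)
    ultimately show ?case using strict_mono_compose[OF r(1) s(1)] by (intro exI[of _ "\<lambda>n. r (s n)"]) auto
  qed
  then obtain r where r: "strict_mono r" "\<And>c. c \<in> D \<Longrightarrow> convergent (\<lambda>n. f (r n) \<bullet> c)"
    using D(1) by blast
  have "(\<lambda>n. f (r n) \<bullet> c) \<longlonglongrightarrow> lim (\<lambda>n. f (r n) \<bullet> c)" if "c \<in> D" for c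
    using r(2)[OF that] by (simp add: convergent_LIMSEQ_iff)
  then have "(\<lambda>n. \<Sum>c\<in>D. ((f (r n) \<bullet> c) / (c \<bullet> c)) *\<^sub>R c)
      \<longlonglongrightarrow> (\<Sum>c\<in>D. (lim (\<lambda>n. f (r n) \<bullet> c) / (c \<bullet> c)) *\<^sub>R c)"
    by (intro tendsto_sum tendsto_scaleR tendsto_const) (auto simp: divide_inverse intro: tendsto_mult)
  then have "(\<lambda>n. f (r n)) \<longlonglongrightarrow> (\<Sum>c\<in>D. (lim (\<lambda>n. f (r n) \<bullet> c) / (c \<bullet> c)) *\<^sub>R c)"
    by (simp only: exp[symmetric])
  then show ?thesis using r(1) unfolding o_def by blast
qed

section \<open>Graphs of maximally monotone operators\<close>

text \<open>Adding the pair \<open>(x, u)\<close> to the graph of \<open>F\<close> keeps it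
  monotone, so by maximality the pair was already there.\<close>

lemma maximally_monotone_memI:
  assumes "maximally_monotone F"
    and "\<And>y v. v \<in> F y \<Longrightarrow> 0 \<le> (u - v) \<bullet> (x - y)"
  shows "u \<in> F x"
proof -
  define G where "G = F(x := insert u (F x))"
  have mono: "0 \<le> (a - b) \<bullet> (y - z)" if "a \<in> F y" "b \<in> F z" for a b y z
    using assms(1) that by (auto simp: maximally_monotone_def monotone_op_def)
  have sym: "(a - b) \<bullet> (y - z) = (b - a) \<bullet> (z - y)" for a b y z :: 'a
    by (simp add: inner_diff_left inner_diff_right)
  have "0 \<le> (a - b) \<bullet> (y - z)" if "a \<in> G y" "b \<in> G z" for a b y z
    using that mono assms(2) sym by (auto simp: G_def sym split: if_splits)
  then have "monotone_op G" by (auto simp: monotone_op_def)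
  moreover have "\<forall>y. F y \<subseteq> G y" by (auto simp: G_def)
  ultimately have "G = F" using assms(1) by (auto simp: maximally_monotone_def)
  then show ?thesis by (metis G_def fun_upd_same insertI1)
qed

text \<open>Monotonicity against a fixed pair of the graph is a closed condition, so it survives the
  limit; maximality then puts the limit into the graph.\<close>

lemma maximally_monotone_limit:
  assumes F: "maximally_monotone F" and "\<And>n. u n \<in> F (x n)"
    and "u \<longlonglongrightarrow> v" and "x \<longlonglongrightarrow> y"
  shows "v \<in> F y"
proof (rule maximally_monotone_memI[OF F])
  fix z w assume "w \<in> F z"
  then have "0 \<le> (u n - w) \<bullet> (x n - z)" for n
    using F assms(2) by (auto simp: maximally_monotone_def monotone_op_def)
  moreover have "(\<lambda>n. (u n - w) \<bullet> (x n - z)) \<longlonglongrightarrow> (v - w) \<bullet> (y - z)"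
    by (intro tendsto_intros assms)
  ultimately show "0 \<le> (v - w) \<bullet> (y - z)"
    by (meson LIMSEQ_le_const)
qed

section \<open>From an error bound to linear convergence\<close>

text \<open>The error bound turns the loss \<open>\<eta> * (r k)\<^sup>2\<close> into a fixed
  fraction of the squared distance. No operator enters: \<open>r\<close> is any sequence for which
  both inequalities hold.\<close>

lemma fejer_linear_convergence:
  fixes S :: "'a::{real_inner, complete_space} \<Rightarrow> 'a" and x :: "nat \<Rightarrow> 'a" and r :: "nat \<Rightarrow> real"
  assumes S: "pos_def_op S" and Z: "closed Z" "Z \<noteq> {}" and \<eta>: "0 < \<eta>"
    and fejer: "\<And>k z. z \<in> Z \<Longrightarrow>
      (norm_op S (x (Suc k) - z))\<^sup>2 \<le> (norm_op S (x k - z))\<^sup>2 - \<eta> * (r k)\<^sup>2"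
    and err: "0 < \<kappa>" "\<And>k. K \<le> k \<Longrightarrow> real_of_ereal (dist_op S (x k) Z) \<le> \<kappa> * r k"
  shows "locally_Q_linear_to_zero (\<lambda>k. real_of_ereal (dist_op S (x k) Z))"
    and "\<exists>l\<in>Z. locally_R_linear_to S x l"
proof -
  define d where "d k = real_of_ereal (dist_op S (x k) Z)" for k
  have d0: "0 \<le> d k" for k by (simp add: d_def dist_op_finite(2)[OF S Z(2)])
  have d_le: "d k \<le> norm_op S (x k - z)" if "z \<in> Z" for k z
    by (simp add: d_def real_dist_op_le[OF S that])
  \<comment> \<open>Chosen so that the error bound gives
    \<open>t * (d k)\<^sup>2 \<le> \<eta> * (r k)\<^sup>2\<close>. As \<open>t\<close> may exceed 1,
    the ratio \<open>c\<close> is built from \<open>max 0 (1 - t)\<close>.\<close>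
  define t where "t = \<eta> / \<kappa>\<^sup>2"
  have t: "0 < t" using \<eta> err(1) by (simp add: t_def)
  define c where "c = sqrt (max 0 (1 - t))"
  have c: "0 \<le> c" "c < 1" using t by (simp_all add: c_def)
  have decr: "d (Suc k) \<le> c * d k" if k: "K \<le> k" for k
  proof -
    have "(d k)\<^sup>2 \<le> (\<kappa> * r k)\<^sup>2" using err(2)[OF k] d0[of k] by (simp add: d_def power_mono)
    then have "t * (d k)\<^sup>2 \<le> t * (\<kappa> * r k)\<^sup>2" using t by (simp add: mult_left_mono)
    also have "\<dots> = \<eta> * (r k)\<^sup>2" using err(1) by (simp add: t_def field_simps)
    finally have *: "t * (d k)\<^sup>2 \<le> \<eta> * (r k)\<^sup>2" .
    \<comment> \<open>The left side does not depend on \<open>z\<close>. The square root makes it a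
      lower bound for all the norms, so that the infimum over \<open>z\<close> can be taken.\<close>
    have "sqrt ((d (Suc k))\<^sup>2 + t * (d k)\<^sup>2) \<le> norm_op S (x k - z)" if z: "z \<in> Z" for z
    proof (rule real_le_lsqrt)
      have "(d (Suc k))\<^sup>2 \<le> (norm_op S (x (Suc k) - z))\<^sup>2"
        using d_le[OF z] d0 by (simp add: power_mono)
      then show "(d (Suc k))\<^sup>2 + t * (d k)\<^sup>2 \<le> (norm_op S (x k - z))\<^sup>2"
        using fejer[OF z, of k] * by linarith
    qed (rule norm_op_nonneg[OF S])
    then have "sqrt ((d (Suc k))\<^sup>2 + t * (d k)\<^sup>2) \<le> d k"
      unfolding d_def[of k] by (intro le_real_dist_op[OF S Z(2)]) (simp add: d_def)
    then have "(d (Suc k))\<^sup>2 + t * (d k)\<^sup>2 \<le> (d k)\<^sup>2" by (rule sqrt_le_D)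
    then have "(d (Suc k))\<^sup>2 \<le> (1 - t) * (d k)\<^sup>2" by (simp add: algebra_simps)
    also have "\<dots> \<le> max 0 (1 - t) * (d k)\<^sup>2" by (intro mult_right_mono) auto
    also have "\<dots> = (c * d k)\<^sup>2" by (simp add: c_def power_mult_distrib)
    finally show ?thesis using c(1) d0[of k] by (metis mult_nonneg_nonneg power2_le_imp_le)
  qed
  then show "locally_Q_linear_to_zero (\<lambda>k. real_of_ereal (dist_op S (x k) Z))"
    using d0 c unfolding locally_Q_linear_to_zero_def d_def by blast
  obtain a b where ab: "0 < a" "0 < b" "\<And>x. a * norm x \<le> norm_op S x" "\<And>x. norm_op S x \<le> b * norm x"
    using norm_op_equivalent_norm[OF S] by metis
  have geo: "d (K + n) \<le> d K * c ^ n" for n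
  proof (induction n)
    case (Suc n)
    have "d (K + Suc n) \<le> c * d (K + n)" using decr[of "K + n"] by simp
    also have "\<dots> \<le> c * (d K * c ^ n)" using Suc c by (intro mult_left_mono)
    finally show ?case by (simp add: algebra_simps)
  qed simp
  have "(\<lambda>n. d K * c ^ n) \<longlonglongrightarrow> d K * 0"
    by (rule tendsto_mult_left[OF LIMSEQ_realpow_zero[OF c]])
  then have "(\<lambda>n. d K * c ^ n) \<longlonglongrightarrow> 0" by simp
  then have "(\<lambda>n. d (n + K)) \<longlonglongrightarrow> 0"
    by (rule tendsto_sandwich[of "\<lambda>_. 0", rotated 3])
      (use geo d0 in \<open>auto simp: add.commute\<close>)
  then have d_lim: "d \<longlonglongrightarrow> 0" by (rule LIMSEQ_offset)
  have dist_mono: "norm_op S (x (k + n) - z) \<le> norm_op S (x k - z)" if "z \<in> Z" for k n z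
  proof (induction n)
    case (Suc n)
    have "0 \<le> \<eta> * (r (k + n))\<^sup>2" using \<eta> by simp
    then have "(norm_op S (x (Suc (k + n)) - z))\<^sup>2 \<le> (norm_op S (x (k + n) - z))\<^sup>2"
      using fejer[OF that, of "k + n"] by linarith
    then have "norm_op S (x (Suc (k + n)) - z) \<le> norm_op S (x (k + n) - z)"
      by (rule power2_le_imp_le) (rule norm_op_nonneg[OF S])
    then show ?case using Suc by simp
  qed simp
  \<comment> \<open>Both points are within \<open>norm_op S (x k - z)\<close> of any
    \<open>z\<close> in \<open>Z\<close>, in the \<open>S\<close>-norm. The triangle inequality
    costs the factor 2, the passage from the \<open>S\<close>-norm to the norm costs
    \<open>1 / a\<close>.\<close>
  have step: "norm (x (k + n) - x k) \<le> 2 / a * d k" for k n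
  proof -
    have "a / 2 * norm (x (k + n) - x k) \<le> norm_op S (x k - z)" if "z \<in> Z" for z
    proof -
      have "a * norm (x (k + n) - x k) \<le> a * norm (x (k + n) - z) + a * norm (x k - z)"
        using ab(1) norm_triangle_ineq4[of "x (k + n) - z" "x k - z"]
        by (simp flip: distrib_left)
      also have "\<dots> \<le> norm_op S (x (k + n) - z) + norm_op S (x k - z)"
        by (intro add_mono ab)
      also have "\<dots> \<le> 2 * norm_op S (x k - z)" using dist_mono[OF that, of k n] by simp
      finally show ?thesis by simp
    qed
    then have "a / 2 * norm (x (k + n) - x k) \<le> d k"
      unfolding d_def by (rule le_real_dist_op[OF S Z(2)])
    then show ?thesis using ab(1) by (simp add: field_simps)
  qed
  have "Cauchy x"
  proof (rule CauchyI')
    fix e :: real assume "0 < e"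
    then have "eventually (\<lambda>k. d k < a / 2 * e) sequentially"
      using d_lim ab(1) by (intro order_tendstoD) auto
    then obtain N where N: "\<And>k. N \<le> k \<Longrightarrow> d k < a / 2 * e" by (auto simp: eventually_sequentially)
    have "norm (x m - x n) < e" if "N \<le> m" "m < n" for m n
    proof -
      have "norm (x m - x n) \<le> 2 / a * d m"
        using step[of m "n - m"] that by (simp add: norm_minus_commute)
      also have "\<dots> < e" using N[OF that(1)] ab(1) by (simp add: field_simps)
      finally show ?thesis .
    qed
    then show "\<exists>M. \<forall>m\<ge>M. \<forall>n>m. dist (x m) (x n) < e" by (auto simp: dist_norm)
  qed
  then obtain l where l: "x \<longlonglongrightarrow> l" using Cauchy_convergent convergent_def by blast
  have lim_err: "norm (x k - l) \<le> 2 / a * d k" for k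
  proof (rule LIMSEQ_le_const2)
    show "(\<lambda>n. norm (x k - x (k + n))) \<longlonglongrightarrow> norm (x k - l)"
      using LIMSEQ_ignore_initial_segment[OF l, of k] by (intro tendsto_intros) (simp add: add.commute)
    show "\<exists>N. \<forall>n\<ge>N. norm (x k - x (k + n)) \<le> 2 / a * d k" using step by (metis norm_minus_commute)
  qed
  \<comment> \<open>A ball of radius \<open>e\<close> around \<open>l\<close> free of
    \<open>Z\<close> would keep late iterates, which are within \<open>e / 2\<close> of
    \<open>l\<close>, at distance at least \<open>e / 2\<close> from \<open>Z\<close>, although
    \<open>d\<close> tends to 0.\<close>
  have "l \<in> Z"
  proof (rule ccontr)
    assume "l \<notin> Z"
    then obtain e where e: "0 < e" "\<And>z. dist z l < e \<Longrightarrow> z \<notin> Z"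
      using Z(1) unfolding closed_def open_dist by auto
    have "eventually (\<lambda>k. dist (x k) l < e / 2) sequentially"
      using l e(1) by (intro tendstoD) auto
    moreover have "eventually (\<lambda>k. d k < a * (e / 2)) sequentially"
      using d_lim ab(1) e(1) by (intro order_tendstoD) auto
    ultimately obtain k where k: "dist (x k) l < e / 2" "d k < a * (e / 2)"
      by (metis (mono_tags, lifting) eventually_conj eventually_sequentially order_refl)
    have "a * (e / 2) \<le> norm_op S (x k - z)" if "z \<in> Z" for z
    proof -
      have "e / 2 \<le> norm (x k - z)"
        using e(2)[of z] that k(1) dist_triangle3[of z l "x k"]
        by (force simp: dist_norm)
      then have "a * (e / 2) \<le> a * norm (x k - z)" using ab(1) by simp
      then show ?thesis using ab(3) order_trans by blast
    qed
    then have "a * (e / 2) \<le> d k" unfolding d_def by (rule le_real_dist_op[OF S Z(2)])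
    then show False using k(2) by simp
  qed
  moreover have "locally_R_linear_to S x l"
  proof -
    \<comment> \<open>\<open>c\<close> may be 0; a positive ratio lets \<open>R\<close> divide by
      \<open>c' ^ K\<close>, which absorbs the start of the decay at index \<open>K\<close>.\<close>
    define c' where "c' = max c (1 / 2)"
    have c': "0 < c'" "c' < 1" "c \<le> c'" using c by (auto simp: c'_def)
    define R where "R = b * (2 / a) * d K / c' ^ K"
    have "norm_op S (x k - l) \<le> R * c' ^ k" if k: "K \<le> k" for k
    proof -
      obtain n where n: "k = K + n" using le_Suc_ex[OF k] by blast
      have "norm_op S (x k - l) \<le> b * norm (x k - l)" by (rule ab(4))
      also have "\<dots> \<le> b * (2 / a * d k)" using ab(2) lim_err[of k] by (intro mult_left_mono) auto
      also have "\<dots> \<le> b * (2 / a * (d K * c' ^ n))"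
      proof -
        have "d k \<le> d K * c ^ n" using geo n by simp
        also have "\<dots> \<le> d K * c' ^ n" using c c' d0 by (intro mult_left_mono power_mono) auto
        finally show ?thesis using ab(1,2) by (intro mult_left_mono) auto
      qed
      also have "\<dots> = R * c' ^ k" using c' by (simp add: R_def n power_add field_simps)
      finally show ?thesis .
    qed
    moreover have "0 \<le> R" using ab d0 c' by (simp add: R_def)
    ultimately show ?thesis unfolding locally_R_linear_to_def using c'
      by (intro exI[of _ K] exI[of _ R] exI[of _ c'] conjI) auto
  qed
  ultimately show "\<exists>l\<in>Z. locally_R_linear_to S x l" by blast
qed

section \<open>Cocoercive operators\<close>

text \<open>With \<open>w\<close> the preimage of \<open>C x - C y\<close> under \<open>P\<close>,
  the \<open>inv P\<close>-norm of the difference is the \<open>P\<close>-norm of \<open>w\<close>,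
  so \<open>inv P\<close> disappears from the later estimates.\<close>

lemma inverse_cocoercive_witness:
  fixes P :: "'a::{real_inner, complete_space} \<Rightarrow> 'a"
  assumes P: "pos_def_op P" and C: "inverse_cocoercive P \<beta> C" and "0 < \<beta>"
  obtains w where "P w = C x - C y" "1 / \<beta> * (norm_op P w)\<^sup>2 \<le> (C x - C y) \<bullet> (x - y)"
proof -
  obtain w where w: "P w = C x - C y" using pos_def_op_bij[OF P] by (metis bij_pointE)
  then have "inv P (C x - C y) = w" using pos_def_op_bij[OF P] by (metis bij_is_inj inv_f_f)
  then have "norm_op (inv P) (C x - C y) = norm_op P w" by (simp add: norm_op_def inner_commute flip: w)
  moreover have "1 / \<beta> * (norm_op (inv P) (C x - C y))\<^sup>2 \<le> (C x - C y) \<bullet> (x - y)"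
    using C assms(3) by (simp add: inverse_cocoercive_def)
  ultimately show thesis using that[OF w] by simp
qed

text \<open>For \<open>v = P w\<close> the bound \<open>norm v \<le> norm w * K\<close> makes the
  cocoercivity term at least a multiple of \<open>(norm v)\<^sup>2\<close>. Cauchy-Schwarz bounds
  the other side by \<open>norm v * norm (x - y)\<close>, and one factor \<open>norm v\<close>
  cancels.\<close>

lemma inverse_cocoercive_lipschitz:
  fixes P :: "'a::{real_inner, complete_space} \<Rightarrow> 'a"
  assumes P: "pos_def_op P" and C: "inverse_cocoercive P \<beta> C" and "0 \<le> \<beta>"
  shows "\<exists>L. L-lipschitz_on UNIV C"
proof (cases "\<beta> = 0")
  case True
  then have "0-lipschitz_on UNIV C" using C by (auto simp: inverse_cocoercive_def lipschitz_on_def)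
  then show ?thesis by blast
next
  case False
  then have \<beta>: "0 < \<beta>" using assms(3) by simp
  obtain l u where l: "0 < l" "\<And>x. l * (norm x)\<^sup>2 \<le> x \<bullet> P x" and bl: "bounded_linear P"
    using pos_def_opE[OF P] by metis
  obtain K where K: "0 < K" "\<And>x. norm (P x) \<le> norm x * K"
    using bounded_linear.pos_bounded[OF bl] by metis
  have "norm (C x - C y) \<le> \<beta> * K\<^sup>2 / l * norm (x - y)" for x y
  proof -
    let ?v = "C x - C y"
    obtain w where w: "P w = ?v" "1 / \<beta> * (norm_op P w)\<^sup>2 \<le> ?v \<bullet> (x - y)"
      using inverse_cocoercive_witness[OF P C \<beta>] by metis
    have "(norm ?v)\<^sup>2 \<le> (norm w * K)\<^sup>2" using K(2)[of w] w(1) by (simp add: power_mono)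
    then have "l / \<beta> * (norm ?v)\<^sup>2 \<le> l / \<beta> * (norm w * K)\<^sup>2" using l(1) \<beta> by (intro mult_left_mono) auto
    also have "\<dots> = K\<^sup>2 * (1 / \<beta> * (l * (norm w)\<^sup>2))" by (simp add: power_mult_distrib)
    also have "\<dots> \<le> K\<^sup>2 * (?v \<bullet> (x - y))"
    proof -
      have "1 / \<beta> * (l * (norm w)\<^sup>2) \<le> 1 / \<beta> * (norm_op P w)\<^sup>2"
        using l(2)[of w] \<beta> by (intro mult_left_mono) (auto simp: norm_op_square[OF P])
      then show ?thesis using w(2) by (intro mult_left_mono) auto
    qed
    also have "\<dots> \<le> K\<^sup>2 * (norm ?v * norm (x - y))"
      by (intro mult_left_mono norm_cauchy_schwarz) simp
    finally have "norm ?v * (l / \<beta> * norm ?v) \<le> norm ?v * (K\<^sup>2 * norm (x - y))"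
      by (simp add: power2_eq_square algebra_simps)
    moreover have "0 \<le> K\<^sup>2 * norm (x - y)" by simp
    ultimately have "l / \<beta> * norm ?v \<le> K\<^sup>2 * norm (x - y)"
      by (cases "?v = 0") (simp, metis mult_le_cancel_left_pos zero_less_norm_iff)
    then show ?thesis using l(1) \<beta> by (simp add: field_simps)
  qed
  then have "(\<beta> * K\<^sup>2 / l)-lipschitz_on UNIV C"
    using \<beta> l(1) by (intro lipschitz_onI) (auto simp: dist_norm)
  then show ?thesis by blast
qed

text \<open>Young's inequality absorbs the cocoercivity term \<open>1/\<beta> \<parallel>C x - C z\<parallel>\<^sup>2\<close>.\<close>

lemma inverse_cocoercive_young:
  fixes P :: "'a::{real_inner, complete_space} \<Rightarrow> 'a"
  assumes P: "pos_def_op P" and C: "inverse_cocoercive P \<beta> C" and "0 \<le> \<beta>"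
  shows "(C x - C z) \<bullet> (z - y) \<le> \<beta> / 4 * (norm_op P (x - y))\<^sup>2"
proof (cases "\<beta> = 0")
  case True
  then obtain c where "\<And>x. C x = c" using C by (auto simp: inverse_cocoercive_def)
  then show ?thesis using True by simp
next
  case False
  then have \<beta>: "0 < \<beta>" using assms(3) by simp
  let ?v = "C x - C z"
  obtain w where w: "P w = ?v" "1 / \<beta> * (norm_op P w)\<^sup>2 \<le> ?v \<bullet> (x - z)"
    using inverse_cocoercive_witness[OF P C \<beta>] by metis
  have lin: "linear P" using P by (simp add: pos_def_op_def bounded_linear.linear)
  have scale: "(norm_op P (s *\<^sub>R w))\<^sup>2 = s\<^sup>2 * (norm_op P w)\<^sup>2" for s
    unfolding norm_op_square[OF P] by (simp add: linear_scale[OF lin] power2_eq_square)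
  \<comment> \<open>The factor \<open>2 / \<beta>\<close> is chosen so that, after multiplication by
    \<open>\<beta> / 4\<close>, the last term is exactly
    \<open>1 / \<beta> * (norm_op P w)\<^sup>2\<close>, the one supplied by cocoercivity.\<close>
  have "0 \<le> (norm_op P ((x - y) + (- 2 / \<beta>) *\<^sub>R w))\<^sup>2" by simp
  also have "\<dots> = (norm_op P (x - y))\<^sup>2 - 4 / \<beta> * (?v \<bullet> (x - y)) + 4 / \<beta>\<^sup>2 * (norm_op P w)\<^sup>2"
    unfolding norm_op_square_add[OF P] scale
    by (simp add: linear_scale[OF lin] linear_neg[OF lin] w(1) inner_commute power_divide)
  finally have "0 \<le> \<beta> / 4 * ((norm_op P (x - y))\<^sup>2 - 4 / \<beta> * (?v \<bullet> (x - y)) + 4 / \<beta>\<^sup>2 * (norm_op P w)\<^sup>2)"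
    using \<beta> by simp
  also have "\<dots> = \<beta> / 4 * (norm_op P (x - y))\<^sup>2 - ?v \<bullet> (x - y) + 1 / \<beta> * (norm_op P w)\<^sup>2"
    using \<beta> by (simp add: field_simps power2_eq_square)
  finally have "?v \<bullet> (x - y) - 1 / \<beta> * (norm_op P w)\<^sup>2 \<le> \<beta> / 4 * (norm_op P (x - y))\<^sup>2" by simp
  moreover have "?v \<bullet> (z - y) = ?v \<bullet> (x - y) - ?v \<bullet> (x - z)" by (simp add: inner_diff_right)
  ultimately show ?thesis using w(2) by linarith
qed

section \<open>Relaxed projection steps\<close>

text \<open>The new point is \<open>x - \<theta> *\<^sub>R (x - p)\<close>. The variational
  inequality makes \<open>(x - z) \<bullet> S (x - p)\<close> at least the squared
  \<open>S\<close>-norm of \<open>x - p\<close>, so expanding the square leaves a loss with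
  coefficient \<open>\<theta> * (2 - \<theta>)\<close>.\<close>

lemma relaxed_projection_fejer:
  fixes S :: "'a::real_inner \<Rightarrow> 'a"
  assumes S: "pos_def_op S" and \<theta>: "\<theta> \<in> {\<epsilon>..2 - \<epsilon>}" and \<epsilon>: "0 < \<epsilon>" "\<epsilon> < 1"
    and p: "(x - p) \<bullet> S (z - p) \<le> 0"
  shows "(norm_op S ((1 - \<theta>) *\<^sub>R x + \<theta> *\<^sub>R p - z))\<^sup>2 \<le> (norm_op S (x - z))\<^sup>2 - \<epsilon> * (norm_op S (x - p))\<^sup>2"
proof -
  have lin: "linear S" and sym: "\<And>x y. S x \<bullet> y = x \<bullet> S y"
    using S by (simp_all add: pos_def_op_def bounded_linear.linear)
  let ?q = "(norm_op S (x - p))\<^sup>2"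
  have eq: "(1 - \<theta>) *\<^sub>R x + \<theta> *\<^sub>R p - z = (x - z) + (- \<theta>) *\<^sub>R (x - p)" by (simp add: algebra_simps)
  have "(x - z) \<bullet> S (x - p) = (x - p) \<bullet> S (x - z)"
    using sym[of "x - z" "x - p"] by (simp add: inner_commute)
  also have "\<dots> = ?q - (x - p) \<bullet> S (z - p)"
    unfolding norm_op_square[OF S] by (simp add: linear_diff[OF lin] inner_diff_right)
  finally have "(x - z) \<bullet> S (x - p) = ?q - (x - p) \<bullet> S (z - p)" .
  then have ge: "?q \<le> (x - z) \<bullet> S (x - p)" using p by simp
  have "(norm_op S ((1 - \<theta>) *\<^sub>R x + \<theta> *\<^sub>R p - z))\<^sup>2
      = (norm_op S (x - z))\<^sup>2 - 2 * \<theta> * ((x - z) \<bullet> S (x - p)) + \<theta>\<^sup>2 * ?q"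
    unfolding eq norm_op_square_add[OF S]
    unfolding norm_op_square[OF S]
    by (simp add: linear_scale[OF lin] linear_neg[OF lin] power2_eq_square)
  also have "\<dots> \<le> (norm_op S (x - z))\<^sup>2 - 2 * \<theta> * ?q + \<theta>\<^sup>2 * ?q"
    using ge \<theta> \<epsilon> by (simp add: mult_left_mono)
  also have "\<dots> = (norm_op S (x - z))\<^sup>2 - (\<theta> * (2 - \<theta>)) * ?q" by (simp add: algebra_simps power2_eq_square)
  also have "\<dots> \<le> (norm_op S (x - z))\<^sup>2 - \<epsilon> * ?q"
  proof -
    \<comment> \<open>\<open>\<theta> * (2 - \<theta>) - \<epsilon>\<close> is the sum of this
      product and the next one.\<close>
    have "0 \<le> (\<theta> - \<epsilon>) * (2 - \<epsilon> - \<theta>)" using \<theta> by simp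
    moreover have "0 \<le> \<epsilon> * (1 - \<epsilon>)" using \<epsilon> by simp
    ultimately have "\<epsilon> \<le> \<theta> * (2 - \<theta>)" by (simp add: algebra_simps)
    then show ?thesis by (simp add: mult_right_mono)
  qed
  finally show ?thesis .
qed

section \<open>The sum \<open>A + C\<close> and its zeros\<close>

text \<open>Both orders occur: \<open>M k + A\<close> in the condition on \<open>xh k\<close>,
  \<open>A + C\<close> in the zeros.\<close>

lemma mem_op_sum_single:
  fixes A :: "'a \<Rightarrow> 'b::ab_group_add set"
  shows "u \<in> op_sum A (single f) y \<longleftrightarrow> u - f y \<in> A y"
    and "u \<in> op_sum (single f) A y \<longleftrightarrow> u - f y \<in> A y"
  by (auto simp: op_sum_def single_def set_plus_def algebra_simps
      intro!: bexI[of _ "u - f y"])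

text \<open>Continuity of \<open>C\<close> reduces this to the closed graph of \<open>A\<close>. It
  serves both for the closedness of the zero set and for recognising cluster points as
  zeros.\<close>

lemma op_sum_single_limit:
  assumes A: "maximally_monotone A" and C: "continuous_on UNIV C"
    and mem: "\<And>n. u n \<in> op_sum A (single C) (x n)" and u: "u \<longlonglongrightarrow> v" and x: "x \<longlonglongrightarrow> y"
  shows "v \<in> op_sum A (single C) y"
proof -
  have "(\<lambda>n. C (x n)) \<longlonglongrightarrow> C y" using continuous_on_tendsto_compose[OF C x] by simp
  then have "(\<lambda>n. u n - C (x n)) \<longlonglongrightarrow> v - C y" by (intro tendsto_diff u)
  moreover have "u n - C (x n) \<in> A (x n)" for n using mem[of n] by (simp add: mem_op_sum_single)
  ultimately have "v - C y \<in> A y" by (intro maximally_monotone_limit[OF A _ _ x])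
  then show ?thesis by (simp add: mem_op_sum_single)
qed

lemma closed_zer_op_sum:
  assumes "maximally_monotone A" and "continuous_on UNIV C"
  shows "closed (zer (op_sum A (single C)))"
  unfolding closed_sequential_limits zer_def
  using op_sum_single_limit[OF assms _ tendsto_const] by blast

text \<open>Here \<open>w\<close> stands for \<open>M k (x k) - M k (xh k)\<close>. Monotonicity of
  \<open>A\<close> compares \<open>w - C x\<close> at \<open>xh\<close> with \<open>- C z\<close> at
  \<open>z\<close>; the remaining inner product with \<open>C x - C z\<close> is bounded by the
  Young estimate.\<close>

lemma zer_subset_halfspace:
  fixes P C :: "'a::{real_inner, complete_space} \<Rightarrow> 'a"
  assumes P: "pos_def_op P" and "0 \<le> \<beta>" and A: "monotone_op A" and C: "inverse_cocoercive P \<beta> C"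
    and xh: "w - C x \<in> A xh" and z: "z \<in> zer (op_sum A (single C))"
  shows "w \<bullet> (z - xh) \<le> \<beta> / 4 * (norm_op P (x - xh))\<^sup>2"
proof -
  have "- C z \<in> A z" using z by (simp add: zer_def mem_op_sum_single)
  then have "0 \<le> (w - C x - (- C z)) \<bullet> (xh - z)"
    using A xh unfolding monotone_op_def by blast
  then have "w \<bullet> (z - xh) \<le> (C x - C z) \<bullet> (z - xh)"
    by (simp add: inner_diff_left inner_diff_right inner_add_left)
  then show ?thesis using inverse_cocoercive_young[OF P C assms(2), of x z xh] by linarith
qed

section \<open>Error bounds and vanishing residuals\<close>

text \<open>Subregularity controls the distance at \<open>xh k\<close>, while the Fejer inequality
  works at \<open>x k\<close>; this transfers the bound. The triangle inequality is used in the
  original norm, which costs the factor \<open>b / a\<close>.\<close>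

lemma real_dist_op_perturb:
  fixes S :: "'a::real_inner \<Rightarrow> 'a"
  assumes S: "pos_def_op S" and Z: "Z \<noteq> {}" and a: "0 < a" "\<And>x. a * norm x \<le> norm_op S x"
    and b: "0 < b" "\<And>x. norm_op S x \<le> b * norm x"
  shows "real_of_ereal (dist_op S x Z) \<le> b * norm (x - y) + b / a * real_of_ereal (dist_op S y Z)"
proof -
  define d where "d = real_of_ereal (dist_op S x Z)"
  have "(d - b * norm (x - y)) * (a / b) \<le> norm_op S (y - z)" if "z \<in> Z" for z
  proof -
    have "d \<le> b * norm (x - z)"
      unfolding d_def using real_dist_op_le[OF S that] b(2) order_trans by blast
    also have "\<dots> \<le> b * (norm (x - y) + norm (y - z))"
      using b(1) norm_triangle_ineq[of "x - y" "y - z"] by simp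
    finally have "d - b * norm (x - y) \<le> b * norm (y - z)" by (simp add: algebra_simps)
    then have "(d - b * norm (x - y)) * (a / b) \<le> b * norm (y - z) * (a / b)"
      using a(1) b(1) by (intro mult_right_mono) auto
    also have "\<dots> \<le> norm_op S (y - z)" using a(2)[of "y - z"] b(1) by (simp add: mult.commute)
    finally show ?thesis .
  qed
  then have "(d - b * norm (x - y)) * (a / b) \<le> real_of_ereal (dist_op S y Z)"
    by (rule le_real_dist_op[OF S Z])
  then show ?thesis using a(1) b(1) by (simp add: d_def field_simps)
qed

text \<open>Since \<open>u k\<close> tends to 0, it eventually lies in the neighborhood
  \<open>V\<close> and competes in the distance from 0 to \<open>F (y k) \<inter> V\<close>, which
  is therefore at most \<open>norm_op S (u k)\<close>.\<close>

lemma metrically_subregular_on_error_bound: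
  fixes S :: "'a::real_inner \<Rightarrow> 'a"
  assumes S: "pos_def_op S" and sub: "metrically_subregular_on S F z 0 U"
    and U: "eventually (\<lambda>k. y k \<in> U) sequentially"
    and u: "\<And>k. u k \<in> F (y k)" "u \<longlonglongrightarrow> 0"
  obtains \<kappa> K where "0 \<le> \<kappa>" "\<And>k::nat. K \<le> k \<Longrightarrow> real_of_ereal (dist_op S (y k) (zer F)) \<le> \<kappa> * norm_op S (u k)"
proof -
  obtain \<kappa> V where \<kappa>: "0 \<le> \<kappa>" and V: "0 \<in> interior V"
    and bound: "\<And>x. x \<in> U \<Longrightarrow> dist_op S x (op_inverse F 0) \<le> ereal \<kappa> * dist_op S 0 (F x \<inter> V)"
    using sub unfolding metrically_subregular_on_def by blast
  have Z: "op_inverse F 0 = zer F" by (simp add: op_inverse_def zer_def)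
  have ne: "zer F \<noteq> {}" using sub by (auto simp: metrically_subregular_on_def zer_def)
  have "eventually (\<lambda>k. u k \<in> interior V) sequentially"
    using u(2) V by (intro topological_tendstoD) auto
  with U have "eventually (\<lambda>k. y k \<in> U \<and> u k \<in> interior V) sequentially"
    by (rule eventually_conj)
  then obtain K where K: "\<And>k. K \<le> k \<Longrightarrow> y k \<in> U \<and> u k \<in> interior V"
    unfolding eventually_sequentially by blast
  have "real_of_ereal (dist_op S (y k) (zer F)) \<le> \<kappa> * norm_op S (u k)" if "K \<le> k" for k
  proof -
    have "u k \<in> F (y k) \<inter> V" using K[OF that] u(1)[of k] interior_subset[of V] by auto
    then have "dist_op S 0 (F (y k) \<inter> V) \<le> ereal (norm_op S (0 - u k))" by (rule dist_op_le)
    also have "norm_op S (0 - u k) = norm_op S (u k)" using norm_op_minus_commute[OF S, of 0 "u k"] by simp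
    finally have "ereal \<kappa> * dist_op S 0 (F (y k) \<inter> V) \<le> ereal \<kappa> * ereal (norm_op S (u k))"
      using \<kappa> by (intro ereal_mult_left_mono) auto
    then have "dist_op S (y k) (zer F) \<le> ereal (\<kappa> * norm_op S (u k))"
      using order_trans[OF bound] K[OF that] by (simp add: Z)
    then show ?thesis using dist_op_finite(1)[OF S ne, of "y k"] by (metis ereal_less_eq(3))
  qed
  then show thesis using that \<kappa> by blast
qed

text \<open>A nonincreasing sequence bounded below converges, so its successive differences, which
  dominate \<open>\<eta> * (r k)\<^sup>2\<close>, tend to 0.\<close>

lemma fejer_residual_tendsto_zero:
  fixes \<phi> r :: "nat \<Rightarrow> real"
  assumes "0 < \<eta>" and "\<And>k. 0 \<le> \<phi> k" and step: "\<And>k. \<phi> (Suc k) \<le> \<phi> k - \<eta> * (r k)\<^sup>2"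
  shows "r \<longlonglongrightarrow> 0"
proof -
  have "0 \<le> \<eta> * (r k)\<^sup>2" for k using assms(1) by simp
  then have "decseq \<phi>" using step by (intro decseq_SucI) (metis diff_ge_0_iff_ge diff_left_mono diff_zero order_trans)
  then obtain g where g: "\<phi> \<longlonglongrightarrow> g" using decseq_convergent[of \<phi> 0] assms(2) by blast
  have "(\<lambda>k. (\<phi> k - \<phi> (Suc k)) / \<eta>) \<longlonglongrightarrow> (g - g) / \<eta>"
    using assms(1) by (intro tendsto_intros g LIMSEQ_Suc) auto
  then have lim: "(\<lambda>k. (\<phi> k - \<phi> (Suc k)) / \<eta>) \<longlonglongrightarrow> 0" by simp
  have "(r k)\<^sup>2 \<le> (\<phi> k - \<phi> (Suc k)) / \<eta>" for k
    using step[of k] assms(1) by (simp add: field_simps)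
  then have "(\<lambda>k. (r k)\<^sup>2) \<longlonglongrightarrow> 0"
    by (intro tendsto_sandwich[OF _ _ tendsto_const lim]) auto
  then show ?thesis by simp
qed

section \<open>Linear convergence of the projection method\<close>

theorem theorem3:
  fixes P S C :: "'a::{real_inner, complete_space} \<Rightarrow> 'a"
    and A :: "'a \<Rightarrow> 'a set"
    and M :: "nat \<Rightarrow> 'a \<Rightarrow> 'a"
    and \<beta> L\<^sub>M \<epsilon> :: real
    and \<theta> :: "nat \<Rightarrow> real"
    and x xh :: "nat \<Rightarrow> 'a"
    and H :: "nat \<Rightarrow> 'a set"
  assumes "pos_def_op P" and "pos_def_op S"
    and "0 \<le> \<beta>" and "\<beta> < 4"
    and "maximally_monotone A"
    and "inverse_cocoercive P \<beta> C"
    and "zer (op_sum A (single C)) \<noteq> {}"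
    and "\<And>k. maximally_monotone (single (M k))"
    and "\<And>k. one_strongly_monotone P (M k)"
    and "\<And>k. L\<^sub>M-lipschitz_on UNIV (M k)"
    and "0 < \<epsilon>" and "\<epsilon> < 1"
    and "\<And>k. \<theta> k \<in> {\<epsilon>..2 - \<epsilon>}"
    and "\<And>k. xh k \<in> op_inverse (op_sum (single (M k)) A) (M k (x k) - C (x k))"
    and "\<And>k. H k = {z. (M k (x k) - M k (xh k)) \<bullet> (z - xh k)
                          \<le> \<beta> / 4 * (norm_op P (x k - xh k))\<^sup>2}"
    and "\<And>k. x (Suc k) = (1 - \<theta> k) *\<^sub>R x k + \<theta> k *\<^sub>R proj_op S (H k) (x k)"
    and "\<And>z. z \<in> zer (op_sum A (single C)) \<Longrightarrow>
           metrically_subregular S (op_sum A (single C)) z 0"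
    and "(\<exists>B::'a set. finite B \<and> span B = UNIV) \<or>
         (\<forall>z \<in> zer (op_sum A (single C)).
            metrically_subregular_on S (op_sum A (single C)) z 0 UNIV)"
  shows "locally_Q_linear_to_zero
           (\<lambda>k. real_of_ereal (dist_op S (x k) (zer (op_sum A (single C))))) \<and>
         (\<exists>l \<in> zer (op_sum A (single C)). locally_R_linear_to S x l)"
proof -
  note P = assms(1) and S = assms(2) and \<beta> = assms(3,4) and A = assms(5) and C = assms(6)
    and Zne = assms(7) and strong = assms(9) and lip = assms(10) and \<epsilon> = assms(11,12)
    and \<theta> = assms(13) and xh = assms(14) and H = assms(15) and xSuc = assms(16)
    and subreg = assms(17) and dichotomy = assms(18)
  define F where "F = op_sum A (single C)"
  define Z where "Z = zer F"
  define p where "p k = proj_op S (H k) (x k)" for k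
  define r where "r k = norm (x k - xh k)" for k
  define w where "w k = M k (x k) - M k (xh k)" for k
  obtain a b where a: "0 < a" "\<And>x. a * norm x \<le> norm_op S x"
    and b: "0 < b" "\<And>x. norm_op S x \<le> b * norm x"
    using norm_op_equivalent_norm[OF S] by metis
  obtain l where l: "0 < l" "\<And>x. l * (norm x)\<^sup>2 \<le> x \<bullet> P x"
    using pos_def_opE[OF P] by metis
  obtain L where L: "L-lipschitz_on UNIV C"
    using inverse_cocoercive_lipschitz[OF P C \<beta>(1)] by blast
  have contC: "continuous_on UNIV C" by (rule lipschitz_on_continuous_on[OF L])
  have clZ: "closed Z" unfolding Z_def F_def by (rule closed_zer_op_sum[OF A contC])
  have Z0: "Z \<noteq> {}" using Zne by (simp add: Z_def F_def)
  have L0: "0 \<le> L\<^sub>M" "0 \<le> L" using lip[of 0] L by (auto simp: lipschitz_on_def)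

  have w_le: "norm (w k) \<le> L\<^sub>M * r k" for k
    using lipschitz_onD[OF lip[of k], of "x k" "xh k"] by (simp add: w_def r_def dist_norm)
  have w_mem: "w k - C (x k) \<in> A (xh k)" for k
    using xh[of k] by (simp add: op_inverse_def mem_op_sum_single w_def algebra_simps)
  have ZH: "z \<in> H k" if "z \<in> Z" for z k
  proof -
    have "monotone_op A" using A by (simp add: maximally_monotone_def)
    moreover have "w k - C (x k) \<in> A (xh k)" by (rule w_mem)
    moreover have "z \<in> zer (op_sum A (single C))" using that by (simp add: Z_def F_def)
    ultimately have "w k \<bullet> (z - xh k) \<le> \<beta> / 4 * (norm_op P (x k - xh k))\<^sup>2"
      by (rule zer_subset_halfspace[OF P \<beta>(1) _ C])
    then show ?thesis by (simp add: H[of k] w_def)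
  qed
  have H': "H k = {z. w k \<bullet> z \<le> \<beta> / 4 * (norm_op P (x k - xh k))\<^sup>2 + w k \<bullet> xh k}" for k
    by (auto simp: H w_def inner_diff_right)
  have Hne: "H k \<noteq> {}" for k using ZH Z0 by blast
  have p_in: "p k \<in> H k" for k
    unfolding p_def by (rule proj_op_halfspace(1)[OF S H' Hne])
  have p_var: "(x k - p k) \<bullet> S (z - p k) \<le> 0" if "z \<in> H k" for k z
    unfolding p_def by (rule proj_op_halfspace(2)[OF S H' Hne that])

  define u where "u k = w k - C (x k) + C (xh k)" for k
  have u_mem: "u k \<in> F (xh k)" for k
    using w_mem[of k] by (simp add: F_def u_def mem_op_sum_single)
  have u_le: "norm (u k) \<le> (L\<^sub>M + L) * r k" for k
  proof -
    have "norm (u k) \<le> norm (w k) + norm (C (x k) - C (xh k))"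
      using norm_triangle_ineq4[of "w k" "C (x k) - C (xh k)"] by (simp add: u_def algebra_simps)
    also have "\<dots> \<le> L\<^sub>M * r k + L * r k"
      using w_le[of k] lipschitz_onD[OF L, of "x k" "xh k"] by (simp add: r_def dist_norm)
    finally show ?thesis by (simp add: algebra_simps)
  qed

  \<comment> \<open>\<open>1 - \<beta> / 4\<close> is what the slack of \<open>H k\<close> leaves of
    the strong monotonicity, and \<open>l\<close> converts the squared \<open>P\<close>-norm to the
    squared norm.\<close>
  define m where "m = (1 - \<beta> / 4) * l"
  have m: "0 < m" using \<beta> l(1) by (simp add: m_def)
  \<comment> \<open>Strong monotonicity bounds \<open>w k \<bullet> (x k - xh k)\<close> from below,
    membership of \<open>p k\<close> in \<open>H k\<close> bounds
    \<open>w k \<bullet> (p k - xh k)\<close> from above, and the difference is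
    \<open>w k \<bullet> (x k - p k)\<close>. The constant is \<open>L\<^sub>M + 1\<close> because
    it becomes a divisor and \<open>L\<^sub>M\<close> may be 0.\<close>
  have res: "m * r k \<le> (L\<^sub>M + 1) * norm (x k - p k)" for k
  proof (cases "r k = 0")
    case True
    then show ?thesis using L0 by simp
  next
    case False
    then have rk: "0 < r k" by (simp add: r_def)
    let ?q = "(norm_op P (x k - xh k))\<^sup>2"
    have "m * (r k)\<^sup>2 = (1 - \<beta> / 4) * (l * (norm (x k - xh k))\<^sup>2)" by (simp add: m_def r_def)
    also have "\<dots> \<le> (1 - \<beta> / 4) * ?q"
      using l(2)[of "x k - xh k"] \<beta> by (intro mult_left_mono) (auto simp: norm_op_square[OF P])
    also have "\<dots> = ?q - \<beta> / 4 * ?q" by (simp add: algebra_simps)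
    also have "\<dots> \<le> w k \<bullet> (x k - xh k) - w k \<bullet> (p k - xh k)"
      using strong[of k] p_in[of k] unfolding H[of k] one_strongly_monotone_def w_def
      by (intro diff_mono) auto
    also have "\<dots> = w k \<bullet> (x k - p k)" by (simp add: inner_diff_right)
    also have "\<dots> \<le> norm (w k) * norm (x k - p k)" by (rule norm_cauchy_schwarz)
    also have "\<dots> \<le> (L\<^sub>M * r k) * norm (x k - p k)" using w_le[of k] by (intro mult_right_mono) auto
    also have "\<dots> \<le> ((L\<^sub>M + 1) * r k) * norm (x k - p k)"
      using rk by (intro mult_right_mono) auto
    finally have "r k * (m * r k) \<le> r k * ((L\<^sub>M + 1) * norm (x k - p k))"
      by (simp add: power2_eq_square mult.assoc mult.left_commute)
    then show ?thesis using rk by (metis mult_le_cancel_left_pos)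
  qed

  \<comment> \<open>\<open>m / (L\<^sub>M + 1)\<close> comes from \<open>res\<close>,
    \<open>a\<close> from passing to the \<open>S\<close>-norm, and \<open>\<epsilon>\<close> from
    the relaxation.\<close>
  define \<eta> where "\<eta> = \<epsilon> * (a * m / (L\<^sub>M + 1))\<^sup>2"
  have \<eta>: "0 < \<eta>" using \<epsilon> a(1) m L0 by (simp add: \<eta>_def)
  have fejer: "(norm_op S (x (Suc k) - z))\<^sup>2 \<le> (norm_op S (x k - z))\<^sup>2 - \<eta> * (r k)\<^sup>2"
    if z: "z \<in> Z" for z k
  proof -
    have "a * (m * r k / (L\<^sub>M + 1)) \<le> a * norm (x k - p k)"
      using res[of k] L0 a(1) by (intro mult_left_mono) (auto simp: field_simps)
    also have "\<dots> \<le> norm_op S (x k - p k)" by (rule a(2))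
    finally have "(a * (m * r k / (L\<^sub>M + 1)))\<^sup>2 \<le> (norm_op S (x k - p k))\<^sup>2"
      using a(1) m L0 by (intro power_mono) (auto simp: r_def)
    then have "\<epsilon> * (a * (m * r k / (L\<^sub>M + 1)))\<^sup>2 \<le> \<epsilon> * (norm_op S (x k - p k))\<^sup>2"
      using \<epsilon> by (intro mult_left_mono) auto
    moreover have "\<epsilon> * (a * (m * r k / (L\<^sub>M + 1)))\<^sup>2 = \<eta> * (r k)\<^sup>2"
      by (simp add: \<eta>_def power_mult_distrib power_divide)
    ultimately show ?thesis
      using relaxed_projection_fejer[OF S \<theta> \<epsilon> p_var[OF ZH[OF z]], of k k] xSuc[of k]
      by (simp add: p_def)
  qed

  obtain z0 where z0: "z0 \<in> Z" using Z0 by blast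
  have r_lim: "r \<longlonglongrightarrow> 0"
    by (rule fejer_residual_tendsto_zero[of \<eta> "\<lambda>k. (norm_op S (x k - z0))\<^sup>2"])
      (use \<eta> fejer[OF z0] in auto)
  have u_lim: "u \<longlonglongrightarrow> 0"
  proof (rule Lim_null_comparison)
    show "\<forall>\<^sub>F k in sequentially. norm (u k) \<le> (L\<^sub>M + L) * r k" using u_le by simp
    show "(\<lambda>k. (L\<^sub>M + L) * r k) \<longlonglongrightarrow> 0" using tendsto_mult_left[OF r_lim] by simp
  qed
  have diff_lim: "(\<lambda>k. x k - xh k) \<longlonglongrightarrow> 0"
    using r_lim unfolding r_def by (rule tendsto_norm_zero_cancel)
  have norm_mono: "decseq (\<lambda>k. norm_op S (x k - z))" if "z \<in> Z" for z
  proof (rule decseq_SucI)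
    fix k
    have "0 \<le> \<eta> * (r k)\<^sup>2" using \<eta> by simp
    then have "(norm_op S (x (Suc k) - z))\<^sup>2 \<le> (norm_op S (x k - z))\<^sup>2"
      using fejer[OF that, of k] by linarith
    then show "norm_op S (x (Suc k) - z) \<le> norm_op S (x k - z)"
      by (rule power2_le_imp_le) (rule norm_op_nonneg[OF S])
  qed

  \<comment> \<open>A single zero suffices, provided that its neighborhood eventually contains
    \<open>xh k\<close>. If \<open>U = UNIV\<close> any zero will do; in finite dimension it is the
    limit of \<open>x\<close>.\<close>
  obtain z U where sub: "metrically_subregular_on S F z 0 U"
    and U: "eventually (\<lambda>k. xh k \<in> U) sequentially"
  proof (cases "\<exists>B::'a set. finite B \<and> span B = UNIV")
    case False
    then have "metrically_subregular_on S F z0 0 UNIV"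
      using dichotomy z0 by (auto simp: Z_def F_def)
    then show thesis using that by simp
  next
    case True
    then obtain B :: "'a set" where B: "finite B" "span B = UNIV" by blast
    have "norm (x k) \<le> norm_op S (x 0 - z0) / a + norm z0" for k
    proof -
      have "a * norm (x k - z0) \<le> norm_op S (x 0 - z0)"
        using a(2)[of "x k - z0"] decseqD[OF norm_mono[OF z0], of 0 k] by simp
      then have "norm (x k - z0) \<le> norm_op S (x 0 - z0) / a" using a(1) by (simp add: field_simps)
      then show ?thesis using norm_triangle_sub[of "x k" z0] by linarith
    qed
    then have "bounded (range x)" by (auto simp: bounded_iff)
    then obtain q s where s: "strict_mono s" "(x \<circ> s) \<longlonglongrightarrow> q"
      using finite_span_convergent_subsequence[OF B] by blast
    have "(\<lambda>n. (x \<circ> s) n - ((\<lambda>k. x k - xh k) \<circ> s) n) \<longlonglongrightarrow> q - 0"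
      by (intro tendsto_diff s(2) LIMSEQ_subseq_LIMSEQ[OF diff_lim s(1)])
    then have "(\<lambda>n. xh (s n)) \<longlonglongrightarrow> q" by (simp add: o_def)
    moreover have "(\<lambda>n. u (s n)) \<longlonglongrightarrow> 0"
      using LIMSEQ_subseq_LIMSEQ[OF u_lim s(1)] by (simp add: o_def)
    ultimately have "0 \<in> F q"
      using op_sum_single_limit[OF A contC, of "\<lambda>n. u (s n)" "\<lambda>n. xh (s n)"] u_mem
      by (simp add: F_def)
    then have q: "q \<in> Z" by (simp add: Z_def zer_def)
    \<comment> \<open>Distances to the zero \<open>q\<close> do not increase in the
      \<open>S\<close>-norm, so one close member of the subsequence keeps all later iterates
      close.\<close>
    have "x \<longlonglongrightarrow> q"
    proof (rule LIMSEQ_I)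
      fix e :: real assume e: "0 < e"
      then obtain n where "norm ((x \<circ> s) n - q) < a * e / b"
        using LIMSEQ_D[OF s(2), of "a * e / b"] a(1) b(1) by auto
      then have "b * norm (x (s n) - q) < a * e" using b(1) by (simp add: field_simps)
      then have n: "norm_op S (x (s n) - q) < a * e" using b(2)[of "x (s n) - q"] by linarith
      have "norm (x k - q) < e" if "s n \<le> k" for k
      proof -
        have "a * norm (x k - q) < a * e"
          using a(2)[of "x k - q"] decseqD[OF norm_mono[OF q] that] n by linarith
        then show ?thesis using a(1) by simp
      qed
      then show "\<exists>no. \<forall>k\<ge>no. norm (x k - q) < e" by blast
    qed
    then have "(\<lambda>k. x k - (x k - xh k)) \<longlonglongrightarrow> q - 0" by (intro tendsto_diff diff_lim)
    then have xh_lim: "xh \<longlonglongrightarrow> q" by simp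
    obtain U where U: "metrically_subregular_on S F q 0 U"
      using subreg[of q] q by (auto simp: metrically_subregular_def Z_def F_def)
    then have "q \<in> interior U" by (simp add: metrically_subregular_on_def)
    then have "eventually (\<lambda>k. xh k \<in> interior U) sequentially"
      using xh_lim by (intro topological_tendstoD) auto
    then have "eventually (\<lambda>k. xh k \<in> U) sequentially"
      by eventually_elim (use interior_subset in blast)
    then show thesis using that U by blast
  qed

  obtain \<kappa> K where \<kappa>: "0 \<le> \<kappa>"
    and bound: "\<And>k. K \<le> k \<Longrightarrow> real_of_ereal (dist_op S (xh k) Z) \<le> \<kappa> * norm_op S (u k)"
    using metrically_subregular_on_error_bound[OF S sub U u_mem u_lim] unfolding Z_def by blast
  \<comment> \<open>The first \<open>b\<close> pays for the move from \<open>xh k\<close> to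
    \<open>x k\<close>; the second term bounds the distance at \<open>xh k\<close> through
    \<open>u k\<close>, with the factor \<open>b / a\<close> of
    \<open>real_dist_op_perturb\<close>.\<close>
  define \<kappa>' where "\<kappa>' = b + b / a * (\<kappa> * (b * (L\<^sub>M + L)))"
  have "0 < \<kappa>'" unfolding \<kappa>'_def using a(1) b(1) \<kappa> L0 by (intro add_pos_nonneg) auto
  moreover have "real_of_ereal (dist_op S (x k) Z) \<le> \<kappa>' * r k" if "K \<le> k" for k
  proof -
    have "norm_op S (u k) \<le> b * ((L\<^sub>M + L) * r k)"
      using b(2)[of "u k"] mult_left_mono[OF u_le[of k], of b] b(1) by linarith
    then have "\<kappa> * norm_op S (u k) \<le> \<kappa> * (b * ((L\<^sub>M + L) * r k))" using \<kappa> by (rule mult_left_mono)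
    then have "real_of_ereal (dist_op S (xh k) Z) \<le> \<kappa> * (b * ((L\<^sub>M + L) * r k))"
      using bound[OF that] by linarith
    then have "b / a * real_of_ereal (dist_op S (xh k) Z) \<le> b / a * (\<kappa> * (b * ((L\<^sub>M + L) * r k)))"
      using a(1) b(1) by (intro mult_left_mono) auto
    then have "real_of_ereal (dist_op S (x k) Z) \<le> b * r k + b / a * (\<kappa> * (b * ((L\<^sub>M + L) * r k)))"
      using real_dist_op_perturb[OF S Z0 a b, of "x k" "xh k"] by (simp add: r_def)
    also have "\<dots> = \<kappa>' * r k" by (simp add: \<kappa>'_def distrib_right mult.assoc)
    finally show ?thesis .
  qed
  ultimately show ?thesis
    using fejer_linear_convergence[where x = x and r = r and K = K, OF S clZ Z0 \<eta> fejer]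
    by (simp add: Z_def F_def)
qed

end
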